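(* For every integer $n\ge 2$, $b_{\rm R}(P_2\times P_n)=2$, where $P_m$ denotes the path on $m$ vertices and $\times$ denotes the Cartesian product of graphs.
   Context: Graphs are finite, undirected, without loops or multiple edges; a graph is nonempty if it has at least one edge. The Cartesian product $G_1\times G_2$ of $G_1=(V_1,E_1)$ and $G_2=(V_2,E_2)$ has vertex set $V_1\times V_2$, and $(x_1,y_1)$, $(x_2,y_2)$ are adjacent if and only if either $x_1=x_2$ and $y_1y_2\in E_2$, or $y_1=y_2$ and $x_1x_2\in E_1$. A Roman dominating function on $G=(V,E)$ is a function $f:V\to\{0,1,2\}$ such that every vertex $x$ with $f(x)=0$ is adjacent to at least one vertex $y$ with $f(y)=2$. Its weight is $\sum_{u\in V}f(u)$. The Roman domination number $\gamma_{\rm R}(G)$ is the minimum weight of a Roman dominating function on $G$. The Roman bondage number of a nonempty graph $G$ is $b_{\rm R}(G)=\min\{|B|: B\subseteq E(G),\ \gamma_{\rm R}(G-B)>\gamma_{\rm R}(G)\}$, with $b_{\rm R}(G)=\infty$ if no such $B$ exists; here $G-B$ is obtained from $G$ by deleting the edges in $B$ (keeping all vertices). *)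

theory Defs
  imports Main "HOL-Library.Extended_Nat"
begin

record 'a graph =
  verts :: "'a set"
  edges :: "'a set set"

definition simple_graph :: "'a graph \<Rightarrow> bool" where
  "simple_graph G \<longleftrightarrow> finite (verts G) \<and>
     (\<forall>e\<in>edges G. \<exists>x\<in>verts G. \<exists>y\<in>verts G. x \<noteq> y \<and> e = {x, y})"

definition adjacent :: "'a graph \<Rightarrow> 'a \<Rightarrow> 'a \<Rightarrow> bool" where
  "adjacent G x y \<longleftrightarrow> {x, y} \<in> edges G"

definition path_graph :: "nat \<Rightarrow> nat graph" where
  "path_graph m = \<lparr>verts = {..<m}, edges = {{i, Suc i} | i. Suc i < m}\<rparr>"

definition cartesian_product :: "'a graph \<Rightarrow> 'b graph \<Rightarrow> ('a \<times> 'b) graph" where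
  "cartesian_product G\<^sub>1 G\<^sub>2 =
     \<lparr>verts = verts G\<^sub>1 \<times> verts G\<^sub>2,
      edges =
        {{(x\<^sub>1, y\<^sub>1), (x\<^sub>2, y\<^sub>2)} | x\<^sub>1 y\<^sub>1 x\<^sub>2 y\<^sub>2.
           x\<^sub>1 \<in> verts G\<^sub>1 \<and> x\<^sub>2 \<in> verts G\<^sub>1 \<and> y\<^sub>1 \<in> verts G\<^sub>2 \<and> y\<^sub>2 \<in> verts G\<^sub>2 \<and>
           (x\<^sub>1 = x\<^sub>2 \<and> adjacent G\<^sub>2 y\<^sub>1 y\<^sub>2 \<or> y\<^sub>1 = y\<^sub>2 \<and> adjacent G\<^sub>1 x\<^sub>1 x\<^sub>2)}\<rparr>"

definition delete_edges :: "'a graph \<Rightarrow> 'a set set \<Rightarrow> 'a graph" where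
  "delete_edges G B = \<lparr>verts = verts G, edges = edges G - B\<rparr>"

(* Only the values of f on verts G matter; f is arbitrary elsewhere. *)
definition roman_dominating :: "'a graph \<Rightarrow> ('a \<Rightarrow> nat) \<Rightarrow> bool" where
  "roman_dominating G f \<longleftrightarrow>
     (\<forall>x\<in>verts G. f x \<in> {0, 1, 2}) \<and>
     (\<forall>x\<in>verts G. f x = 0 \<longrightarrow> (\<exists>y\<in>verts G. adjacent G x y \<and> f y = 2))"

definition weight :: "'a graph \<Rightarrow> ('a \<Rightarrow> nat) \<Rightarrow> nat" where
  "weight G f = (\<Sum>u\<in>verts G. f u)"

(* The infimum over nat is attained, since the constant function 2 is Roman dominating. *)
definition roman_domination_number :: "'a graph \<Rightarrow> nat" where
  "roman_domination_number G = Inf (weight G ` {f. roman_dominating G f})"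

(* In enat, the infimum of a nonempty set is its minimum and the infimum of the empty set is
   \<infinity>. Meant for simple graphs with at least one edge. *)
definition roman_bondage_number :: "'a graph \<Rightarrow> enat" where
  "roman_bondage_number G =
     Inf {enat (card B) | B. B \<subseteq> edges G \<and>
            roman_domination_number (delete_edges G B) > roman_domination_number G}"

lemma simple_graph_path_graph: "simple_graph (path_graph m)"
  unfolding simple_graph_def
proof (intro conjI ballI)
  show "finite (verts (path_graph m))"
    by (simp add: path_graph_def)
next
  fix e assume "e \<in> edges (path_graph m)"
  then obtain i where "e = {i, Suc i}" "Suc i < m"
    by (auto simp: path_graph_def)
  thus "\<exists>x\<in>verts (path_graph m). \<exists>y\<in>verts (path_graph m). x \<noteq> y \<and> e = {x, y}"
    by (intro bexI[of _ i] bexI[of _ "Suc i"]) (auto simp: path_graph_def)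
qed

lemma simple_graph_cartesian_product:
  assumes "simple_graph G\<^sub>1" "simple_graph G\<^sub>2"
  shows "simple_graph (cartesian_product G\<^sub>1 G\<^sub>2)"
proof -
  have irr1: "x \<noteq> y" if "adjacent G\<^sub>1 x y" for x y
  proof
    assume "x = y"
    with that have "{y} \<in> edges G\<^sub>1" by (simp add: adjacent_def)
    then obtain a b where "a \<noteq> b" "{y} = {a, b}"
      using assms(1) unfolding simple_graph_def by meson
    thus False by blast
  qed
  have irr2: "x \<noteq> y" if "adjacent G\<^sub>2 x y" for x y
  proof
    assume "x = y"
    with that have "{y} \<in> edges G\<^sub>2" by (simp add: adjacent_def)
    then obtain a b where "a \<noteq> b" "{y} = {a, b}"
      using assms(2) unfolding simple_graph_def by meson
    thus False by blast
  qed
  show ?thesis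
    unfolding simple_graph_def
  proof (intro conjI ballI)
    show "finite (verts (cartesian_product G\<^sub>1 G\<^sub>2))"
      using assms by (simp add: simple_graph_def cartesian_product_def)
  next
    fix e assume "e \<in> edges (cartesian_product G\<^sub>1 G\<^sub>2)"
    then obtain x\<^sub>1 y\<^sub>1 x\<^sub>2 y\<^sub>2 where e: "e = {(x\<^sub>1, y\<^sub>1), (x\<^sub>2, y\<^sub>2)}"
      and v: "(x\<^sub>1, y\<^sub>1) \<in> verts G\<^sub>1 \<times> verts G\<^sub>2" "(x\<^sub>2, y\<^sub>2) \<in> verts G\<^sub>1 \<times> verts G\<^sub>2"
      and adj: "x\<^sub>1 = x\<^sub>2 \<and> adjacent G\<^sub>2 y\<^sub>1 y\<^sub>2 \<or> y\<^sub>1 = y\<^sub>2 \<and> adjacent G\<^sub>1 x\<^sub>1 x\<^sub>2"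
      by (auto simp: cartesian_product_def)
    have "(x\<^sub>1, y\<^sub>1) \<noteq> (x\<^sub>2, y\<^sub>2)" using adj irr1 irr2 by blast
    moreover have "(x\<^sub>1, y\<^sub>1) \<in> verts (cartesian_product G\<^sub>1 G\<^sub>2)"
      "(x\<^sub>2, y\<^sub>2) \<in> verts (cartesian_product G\<^sub>1 G\<^sub>2)"
      using v by (simp_all add: cartesian_product_def)
    ultimately show "\<exists>x\<in>verts (cartesian_product G\<^sub>1 G\<^sub>2). \<exists>y\<in>verts (cartesian_product G\<^sub>1 G\<^sub>2). x \<noteq> y \<and> e = {x, y}"
      using e by blast
  qed
qed

lemma simple_graph_delete_edges: "simple_graph G \<Longrightarrow> simple_graph (delete_edges G B)"
  by (auto simp: simple_graph_def delete_edges_def)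

lemma roman_domination_number_attained:
  "\<exists>f. roman_dominating G f \<and> weight G f = roman_domination_number G"
proof -
  have "roman_dominating G (\<lambda>_. 2)"
    by (simp add: roman_dominating_def)
  hence "roman_domination_number G \<in> weight G ` {f. roman_dominating G f}"
    unfolding roman_domination_number_def by (intro Inf_nat_def1) auto
  thus ?thesis by auto
qed

end

theory Submission
  imports Defs
begin

text \<open>
  Write \<open>L\<close> for the ladder with \<open>n\<close> columns and two rows. Everything rests on its Roman domination
  number being exactly \<open>n + 1\<close>, in a form that controls both directions.

  Lower bound on the bondage number: there are Roman dominating functions of weight \<open>n + 1\<close> in which
  the vertices of value 2 zigzag between the rows, one in every second column
  (\<open>roman_dominating_zigzag\<close>, \<open>weight_zigzag\<close>). Such a function relies on the rungs of one parity only
  and on just one of the two horizontal edges between consecutive columns. Choosing the parity avoids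
  any given rung, and exchanging the rows avoids any given horizontal edge, so the deletion of a
  single edge leaves the Roman domination number at \<open>n + 1\<close>.

  Upper bound: cutting both horizontal edges between the first two columns leaves a ladder with one
  column and a ladder with \<open>n - 1\<close> columns. A ladder with \<open>k\<close> columns costs at least \<open>k + 1\<close>
  (\<open>ladder_weight_ge\<close>), so the two pieces together cost at least \<open>2 + n\<close>.

  The bound \<open>k + 1\<close> comes from reading the ladder from left to right, with the number of vertices of
  the current column that still wait to be dominated from the right as a potential.
\<close>

section \<open>The ladder as a graph\<close>

abbreviation ladder :: "nat \<Rightarrow> (nat \<times> nat) graph" where
  "ladder n \<equiv> cartesian_product (path_graph 2) (path_graph n)"

lemma verts_ladder: "verts (ladder n) = {..<2} \<times> {..<n}"
  by (simp add: cartesian_product_def path_graph_def)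

lemma adjacent_path_graph: "adjacent (path_graph m) i j \<longleftrightarrow> i < m \<and> j < m \<and> (j = Suc i \<or> i = Suc j)"
  by (auto simp: adjacent_def path_graph_def doubleton_eq_iff)

lemma adjacent_cartesian_product:
  "adjacent (cartesian_product G H) (x, y) (x', y') \<longleftrightarrow>
     x \<in> verts G \<and> x' \<in> verts G \<and> y \<in> verts H \<and> y' \<in> verts H \<and>
     (x = x' \<and> adjacent H y y' \<or> y = y' \<and> adjacent G x x')"
proof -
  have "adjacent K a b \<longleftrightarrow> adjacent K b a" for K :: "'c graph" and a b
    by (simp add: adjacent_def insert_commute)
  note H = this[of H] and G = this[of G]
  have "adjacent (cartesian_product G H) (x, y) (x', y') \<longleftrightarrow>
      (\<exists>x\<^sub>1 y\<^sub>1 x\<^sub>2 y\<^sub>2. {(x, y), (x', y')} = {(x\<^sub>1, y\<^sub>1), (x\<^sub>2, y\<^sub>2)} \<and>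
         x\<^sub>1 \<in> verts G \<and> x\<^sub>2 \<in> verts G \<and> y\<^sub>1 \<in> verts H \<and> y\<^sub>2 \<in> verts H \<and>
         (x\<^sub>1 = x\<^sub>2 \<and> adjacent H y\<^sub>1 y\<^sub>2 \<or> y\<^sub>1 = y\<^sub>2 \<and> adjacent G x\<^sub>1 x\<^sub>2))"
    unfolding adjacent_def[of "cartesian_product G H"] by (simp add: cartesian_product_def)
  thus ?thesis
    unfolding doubleton_eq_iff prod.inject using G H by blast
qed

lemma adjacent_ladder:
  "adjacent (ladder n) (r, c) (r', c') \<longleftrightarrow> r < 2 \<and> r' < 2 \<and> c < n \<and> c' < n \<and>
     (r = r' \<and> (c' = Suc c \<or> c = Suc c') \<or> c = c' \<and> r \<noteq> r')"
proof -
  have v: "verts (path_graph m) = {..<m}" for m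
    by (simp add: path_graph_def)
  show ?thesis
    unfolding adjacent_cartesian_product adjacent_path_graph v lessThan_iff by presburger
qed

lemma adjacent_delete_edges:
  "adjacent (delete_edges G B) x y \<longleftrightarrow> adjacent G x y \<and> {x, y} \<notin> B"
  by (simp add: adjacent_def delete_edges_def)

lemma verts_delete_edges: "verts (delete_edges G B) = verts G"
  by (simp add: delete_edges_def)

lemma finite_edges:
  assumes "simple_graph G" shows "finite (edges G)"
proof (rule finite_subset)
  show "edges G \<subseteq> Pow (verts G)"
    using assms by (auto simp: simple_graph_def)
  show "finite (Pow (verts G))"
    using assms by (simp add: simple_graph_def)
qed

lemma weight_ladder: "weight (ladder n) f = (\<Sum>c<n. f (0, c) + f (1, c))"
proof -
  have two: "{..<2} = {0, 1::nat}" by auto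
  have "weight (ladder n) f = (\<Sum>r<2. \<Sum>c<n. f (r, c))"
    unfolding weight_def verts_ladder by (simp add: sum.cartesian_product)
  thus ?thesis by (simp add: two sum.distrib)
qed

lemma roman_domination_number_le:
  "roman_dominating G f \<Longrightarrow> roman_domination_number G \<le> weight G f"
  unfolding roman_domination_number_def by (intro cInf_lower) auto

section \<open>Every Roman dominating function of a ladder has weight at least one more than its length\<close>

text \<open>Roman domination of a ladder with \<open>n\<close> columns in terms of its two rows \<open>a\<close> and \<open>b\<close>. Free of
  vertex names, it applies equally to a stretch of consecutive columns.\<close>

definition row_dominated :: "(nat \<Rightarrow> nat) \<Rightarrow> (nat \<Rightarrow> nat) \<Rightarrow> nat \<Rightarrow> bool" where
  "row_dominated a b n \<longleftrightarrow> (\<forall>j<n. a j \<le> 2 \<and>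
     (a j = 0 \<longrightarrow> b j = 2 \<or> (\<exists>i<j. j = Suc i \<and> a i = 2) \<or> (Suc j < n \<and> a (Suc j) = 2)))"

definition waiting :: "(nat \<Rightarrow> nat) \<Rightarrow> (nat \<Rightarrow> nat) \<Rightarrow> nat \<Rightarrow> nat" where
  "waiting a b j = (if a j = 0 \<and> b j \<noteq> 2 \<and> \<not> (\<exists>i<j. j = Suc i \<and> a i = 2) then 1 else 0)"

lemma waiting_le_1: "waiting a b j \<le> 1"
  by (simp add: waiting_def)

lemma waiting_imp_next:
  "row_dominated a b n \<Longrightarrow> Suc j < n \<Longrightarrow> waiting a b j \<noteq> 0 \<Longrightarrow> a (Suc j) = 2"
  unfolding row_dominated_def waiting_def by (metis Suc_lessD)

lemma waiting_Suc:
  "waiting a b (Suc j) = (if a (Suc j) = 0 \<and> b (Suc j) \<noteq> 2 \<and> a j \<noteq> 2 then 1 else 0)"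
  by (auto simp: waiting_def)

text \<open>Up to column \<open>j\<close> the weight is at least the number of columns plus one, less one for each
  vertex that the next column must still serve. The bonus for a column with two 2s is what
  keeps the induction going: such a column dominates both vertices of a following column of weight 0,
  whose vertices then do not wait, so that the extra column is paid for in advance.\<close>

lemma prefix_weight_ge:
  assumes a: "row_dominated a b n" and b: "row_dominated b a n" and "j < n"
  shows "j + 2 + (if a j = 2 \<and> b j = 2 then 1 else 0)
           \<le> (\<Sum>c\<le>j. a c + b c) + waiting a b j + waiting b a j"
  using \<open>j < n\<close>
proof (induction j)
  case 0
  thus ?case by (auto simp: waiting_def)
next
  case (Suc j)
  have le2: "a (Suc j) \<le> 2" "b (Suc j) \<le> 2" "a j \<le> 2" "b j \<le> 2"
    using a b Suc.prems by (auto simp: row_dominated_def)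
  have wa: "waiting a b j = 0 \<or> a (Suc j) = 2" and wb: "waiting b a j = 0 \<or> b (Suc j) = 2"
    using waiting_imp_next[OF a Suc.prems] waiting_imp_next[OF b Suc.prems] by auto
  show ?case
    using Suc.IH[OF Suc_lessD[OF Suc.prems]] wa wb le2 waiting_le_1[of a b j] waiting_le_1[of b a j]
    unfolding waiting_Suc sum.atMost_Suc
    by (cases "a (Suc j) = 2"; cases "b (Suc j) = 2"; cases "a j = 2"; cases "b j = 2") auto
qed

lemma ladder_weight_ge:
  assumes a: "row_dominated a b n" and b: "row_dominated b a n" and "n \<ge> 1"
  shows "n + 1 \<le> (\<Sum>c<n. a c + b c)"
proof -
  obtain m where n: "n = Suc m" using \<open>n \<ge> 1\<close> by (cases n) auto
  \<comment> \<open>No column follows the last one, so nothing there can still wait.\<close>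
  have "waiting a b m = 0" "waiting b a m = 0"
    using a b unfolding n row_dominated_def waiting_def by auto
  thus ?thesis
    using prefix_weight_ge[OF a b, of m] by (simp add: n lessThan_Suc_atMost)
qed

lemma row_dominated_of_roman_dominating:
  assumes "roman_dominating (ladder n) f" and "{r, r'} = {0, 1}"
  shows "row_dominated (\<lambda>c. f (r, c)) (\<lambda>c. f (r', c)) n"
  unfolding row_dominated_def
proof (intro allI impI conjI)
  fix c assume "c < n"
  have r: "r < 2" "r' < 2" "x < 2 \<Longrightarrow> x \<noteq> r \<Longrightarrow> x = r'" for x
    using assms(2) by (auto simp: doubleton_eq_iff)
  have v: "(r, c) \<in> verts (ladder n)" using r \<open>c < n\<close> by (simp add: verts_ladder)
  show "f (r, c) \<le> 2"
    using assms(1) v by (auto simp: roman_dominating_def)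
  assume "f (r, c) = 0"
  then obtain x c' where "adjacent (ladder n) (r, c) (x, c')" and "f (x, c') = 2"
    using assms(1) v unfolding roman_dominating_def by (metis surj_pair)
  thus "f (r', c) = 2 \<or> (\<exists>i<c. c = Suc i \<and> f (r, i) = 2) \<or> (Suc c < n \<and> f (r, Suc c) = 2)"
    using r(3)[of x] by (auto simp: adjacent_ladder)
qed

lemma roman_domination_number_ladder_ge:
  assumes "n \<ge> 1" shows "n + 1 \<le> roman_domination_number (ladder n)"
proof -
  obtain f where f: "roman_dominating (ladder n) f"
    "weight (ladder n) f = roman_domination_number (ladder n)"
    using roman_domination_number_attained by blast
  show ?thesis
    using ladder_weight_ge[OF row_dominated_of_roman_dominating[OF f(1)]
        row_dominated_of_roman_dominating[OF f(1)] assms, of 0 1]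
    by (simp add: weight_ladder flip: f(2)) auto
qed

section \<open>Cutting off the first column\<close>

definition first_cut :: "(nat \<times> nat) set set" where
  "first_cut = {{(0, 0), (0, 1)}, {(1, 0), (1, 1)}}"

lemma card_first_cut: "card first_cut = 2"
  by (simp add: first_cut_def doubleton_eq_iff)

lemma first_cut_subset:
  assumes "n \<ge> 2" shows "first_cut \<subseteq> edges (ladder n)"
proof -
  have "adjacent (ladder n) (r, 0) (r, 1)" if "r < 2" for r
    using assms that by (simp add: adjacent_ladder)
  from this[of 0] this[of 1] show ?thesis
    by (simp add: first_cut_def adjacent_def)
qed

lemma rows_dominated_of_cut:
  assumes "roman_dominating (delete_edges (ladder (Suc m)) first_cut) f" and "{r, r'} = {0, 1}"
  shows "row_dominated (\<lambda>c. f (r, c)) (\<lambda>c. f (r', c)) 1"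
    and "row_dominated (\<lambda>c. f (r, Suc c)) (\<lambda>c. f (r', Suc c)) m"
proof -
  have r: "r < 2" "r' < 2" "x < 2 \<Longrightarrow> x \<noteq> r \<Longrightarrow> x = r'" for x
    using assms(2) by (auto simp: doubleton_eq_iff)
  have le2: "f (r, c) \<le> 2" if "c < Suc m" for c
  proof -
    have "(r, c) \<in> verts (delete_edges (ladder (Suc m)) first_cut)"
      using r that by (simp add: verts_delete_edges verts_ladder)
    thus ?thesis using assms(1) by (auto simp: roman_dominating_def)
  qed
  have cut: "{(r, 0), (r, Suc 0)} \<in> first_cut"
    using assms(2) by (auto simp: first_cut_def doubleton_eq_iff)
  have dom: "f (r', c) = 2 \<or> (\<exists>i>0. c = Suc i \<and> f (r, i) = 2) \<or>
      (c > 0 \<and> Suc c < Suc m \<and> f (r, Suc c) = 2)" if c: "c < Suc m" and zero: "f (r, c) = 0" for c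
  proof -
    have "(r, c) \<in> verts (delete_edges (ladder (Suc m)) first_cut)"
      using r c by (simp add: verts_delete_edges verts_ladder)
    then obtain x c' where adj: "adjacent (ladder (Suc m)) (r, c) (x, c')"
      and nc: "{(r, c), (x, c')} \<notin> first_cut" and two: "f (x, c') = 2"
      using assms(1) zero unfolding roman_dominating_def adjacent_delete_edges
      by (metis surj_pair)
    have "\<not> (x = r \<and> c = 0 \<and> c' = Suc 0)" "\<not> (x = r \<and> c' = 0 \<and> c = Suc 0)"
      using cut nc by (auto simp: insert_commute)
    thus ?thesis
      using adj two r(3)[of x] by (auto simp: adjacent_ladder)
  qed
  show "row_dominated (\<lambda>c. f (r, c)) (\<lambda>c. f (r', c)) 1"
    using le2[of 0] dom[of 0] by (auto simp: row_dominated_def)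
  show "row_dominated (\<lambda>c. f (r, Suc c)) (\<lambda>c. f (r', Suc c)) m"
    unfolding row_dominated_def
  proof (intro allI impI conjI)
    fix c assume c: "c < m"
    show "f (r, Suc c) \<le> 2" using le2 c by simp
    assume "f (r, Suc c) = 0"
    with dom[of "Suc c"] c
    show "f (r', Suc c) = 2 \<or> (\<exists>i<c. c = Suc i \<and> f (r, Suc i) = 2) \<or>
        (Suc c < m \<and> f (r, Suc (Suc c)) = 2)"
      by (auto simp: gr0_conv_Suc)
  qed
qed

lemma roman_domination_number_first_cut_ge:
  assumes "n \<ge> 2" shows "n + 2 \<le> roman_domination_number (delete_edges (ladder n) first_cut)"
proof -
  obtain m where n: "n = Suc m" and m: "m \<ge> 1" using assms by (cases n) auto
  let ?G = "delete_edges (ladder (Suc m)) first_cut"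
  obtain f where f: "roman_dominating ?G f" "weight ?G f = roman_domination_number ?G"
    using roman_domination_number_attained by blast
  have rows: "{0, 1} = {0, 1::nat}" "{1, 0} = {0, 1::nat}" by auto
  note R = rows_dominated_of_cut[OF f(1) rows(1)] rows_dominated_of_cut[OF f(1) rows(2)]
  have "2 \<le> f (0, 0) + f (1, 0)"
    using ladder_weight_ge[OF R(1) R(3)] by simp
  moreover have "m + 1 \<le> (\<Sum>c<m. f (0, Suc c) + f (1, Suc c))"
    using ladder_weight_ge[OF R(2) R(4) m] .
  moreover have "weight ?G f = weight (ladder (Suc m)) f"
    by (simp add: weight_def verts_delete_edges)
  ultimately show ?thesis
    unfolding n weight_ladder sum.lessThan_Suc_shift f(2)[symmetric] by simp
qed

section \<open>Zigzag functions, and the deletion of a single edge\<close>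

text \<open>The row of the only horizontal edge between columns \<open>c\<close> and \<open>c + 1\<close> that the zigzag function
  below relies on. In a column \<open>c\<close> of parity \<open>p\<close>, the edges on both sides lie in the same row, which
  is the row of the vertex of value 2; in the other columns the row switches. The parameter \<open>s\<close> selects
  one of the two mirror images.\<close>

definition zigzag_row :: "nat \<Rightarrow> nat \<Rightarrow> nat \<Rightarrow> nat" where
  "zigzag_row p s c = ((c + 1 - p) div 2 + s) mod 2"

text \<open>The value 1 occurs only in the first and the last column, where one side neighbour is missing.\<close>

definition zigzag :: "nat \<Rightarrow> nat \<Rightarrow> nat \<Rightarrow> nat \<times> nat \<Rightarrow> nat" where
  "zigzag n p s = (\<lambda>(r, c).
     if c mod 2 = p then if r = zigzag_row p s c then 2 else 0
     else if (c > 0 \<and> r = zigzag_row p s (c - 1)) \<or> (Suc c < n \<and> r = zigzag_row p s c) then 0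
     else 1)"

lemma zigzag_row_less_2: "zigzag_row p s c < 2"
  by (simp add: zigzag_row_def)

lemma zigzag_row_Suc:
  assumes "p < 2"
  shows "zigzag_row p s (Suc c) = zigzag_row p s c \<longleftrightarrow> Suc c mod 2 = p"
proof -
  have "p = 0 \<or> p = 1" using assms by auto
  thus ?thesis unfolding zigzag_row_def by (elim disjE; simp; presburger)
qed

lemma roman_dominating_zigzag:
  assumes p: "p < 2"
    and rungs: "\<And>c. c < n \<Longrightarrow> c mod 2 = p \<Longrightarrow> {(0, c), (1, c)} \<notin> B"
    and rails: "\<And>c. Suc c < n \<Longrightarrow> {(zigzag_row p s c, c), (zigzag_row p s c, Suc c)} \<notin> B"
  shows "roman_dominating (delete_edges (ladder n) B) (zigzag n p s)"
  unfolding roman_dominating_def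
proof (intro conjI ballI impI)
  fix x assume "x \<in> verts (delete_edges (ladder n) B)"
  then obtain r c where x: "x = (r, c)" and r: "r < 2" and c: "c < n"
    by (auto simp: verts_delete_edges verts_ladder)
  show "zigzag n p s x \<in> {0, 1, 2}"
    by (simp add: x zigzag_def)
  have witness: "\<exists>y\<in>verts (delete_edges (ladder n) B).
      adjacent (delete_edges (ladder n) B) x y \<and> zigzag n p s y = 2"
    if "adjacent (ladder n) (r, c) (r', c')" "{(r, c), (r', c')} \<notin> B"
      "c' mod 2 = p" "r' = zigzag_row p s c'" for r' c'
    by (rule bexI[of _ "(r', c')"])
       (use that in \<open>auto simp: x adjacent_delete_edges zigzag_def adjacent_ladder
          verts_delete_edges verts_ladder\<close>)
  assume zero: "zigzag n p s x = 0"
  show "\<exists>y\<in>verts (delete_edges (ladder n) B).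
      adjacent (delete_edges (ladder n) B) x y \<and> zigzag n p s y = 2"
  proof (cases "c mod 2 = p")
    case True
    hence ne: "r \<noteq> zigzag_row p s c" using zero by (auto simp: x zigzag_def)
    have "{r, zigzag_row p s c} = {0, 1}"
      using ne r zigzag_row_less_2[of p s c] by (auto simp: less_2_cases_iff)
    hence "{(r, c), (zigzag_row p s c, c)} = {(0, c), (1, c)}"
      by (auto simp: doubleton_eq_iff)
    hence "{(r, c), (zigzag_row p s c, c)} \<notin> B"
      using rungs[OF c True] by simp
    thus ?thesis
      using True ne r c zigzag_row_less_2[of p s c]
      by (intro witness[of "zigzag_row p s c" c]) (auto simp: adjacent_ladder)
  next
    case False
    hence next_p: "Suc c mod 2 = p" using p by presburger
    consider "c > 0" "r = zigzag_row p s (c - 1)" | "Suc c < n" "r = zigzag_row p s c"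
      using zero False by (auto simp: x zigzag_def split: if_splits)
    thus ?thesis
    proof cases
      case 1
      then obtain d where d: "c = Suc d" by (cases c) auto
      have "d mod 2 = p" using False p d by presburger
      thus ?thesis
        using 1 c r rails[of d]
        by (intro witness[of r d]) (auto simp: d adjacent_ladder insert_commute)
    next
      case 2
      thus ?thesis
        using next_p r rails[of c] zigzag_row_Suc[OF p, of s c]
        by (intro witness[of r "Suc c"]) (auto simp: adjacent_ladder)
    qed
  qed
qed

lemma sum_parity_columns:
  fixes n p :: nat
  assumes "p < 2" shows "(\<Sum>c<n. if c mod 2 = p then 2 else 0) = 2 * ((n + 1 - p) div 2)"
proof (induction n)
  case 0
  thus ?case using assms by (auto simp: less_2_cases_iff)
next
  case (Suc n)
  have "p = 0 \<or> p = 1" using assms by auto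
  thus ?case using Suc by (elim disjE; simp; presburger)
qed

lemma weight_zigzag:
  assumes p: "p < 2" and n: "n \<ge> 2"
  shows "weight (ladder n) (zigzag n p s) = n + 1"
proof -
  let ?two = "\<lambda>c. if c mod 2 = p then 2 else 0 :: nat"
  let ?end = "\<lambda>k c. if c = k then (if k mod 2 = p then 0 else 1) else 0 :: nat"
  have column: "zigzag n p s (0, c) + zigzag n p s (1, c) = ?two c + ?end 0 c + ?end (n - 1) c"
    if "c < n" for c
  proof (cases "c mod 2 = p")
    case True
    thus ?thesis
      using zigzag_row_less_2[of p s c] by (auto simp: zigzag_def less_2_cases_iff)
  next
    case False
    \<comment> \<open>The two side neighbours serve different rows, hence the whole column if both exist.\<close>
    have switch: "zigzag_row p s c \<noteq> zigzag_row p s (c - 1)" if "c > 0"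
      using zigzag_row_Suc[OF p, of s "c - 1"] False that by simp
    have row: "zigzag_row p s d = 0 \<or> zigzag_row p s d = 1" for d
      using zigzag_row_less_2[of p s d] by (simp add: less_2_cases_iff)
    have val: "zigzag n p s (r, c) =
        (if (c > 0 \<and> r = zigzag_row p s (c - 1)) \<or> (Suc c < n \<and> r = zigzag_row p s c) then 0 else 1)"
      for r
      using False by (simp add: zigzag_def)
    consider "c = 0" "Suc c < n" "c \<noteq> n - 1" | "c > 0" "c = n - 1" "\<not> Suc c < n"
      | "c > 0" "c \<noteq> n - 1" "Suc c < n"
      using \<open>c < n\<close> n by linarith
    thus ?thesis
    proof cases
      case 1
      thus ?thesis using False row[of c] unfolding val by (elim disjE; simp)
    next
      case 2
      have "(n - 1) mod 2 \<noteq> p" using False 2(2) by simp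
      thus ?thesis using 2(1,3) row[of "c - 1"] unfolding val 2(2)[symmetric] by (elim disjE; simp)
    next
      case 3
      thus ?thesis using False switch row[of c] row[of "c - 1"] unfolding val
        by (elim disjE; simp)
    qed
  qed
  have "weight (ladder n) (zigzag n p s) = (\<Sum>c<n. ?two c + ?end 0 c + ?end (n - 1) c)"
    unfolding weight_ladder by (intro sum.cong) (use column in auto)
  also have "\<dots> = (\<Sum>c<n. ?two c) + (\<Sum>c<n. ?end 0 c) + (\<Sum>c<n. ?end (n - 1) c)"
    by (simp add: sum.distrib)
  also have "(\<Sum>c<n. ?end 0 c) = (if 0 mod 2 = p then 0 else 1)"
    using n by (subst sum.delta) auto
  also have "(\<Sum>c<n. ?end (n - 1) c) = (if (n - 1) mod 2 = p then 0 else 1)"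
    using n by (subst sum.delta) auto
  also have "(\<Sum>c<n. ?two c) = 2 * ((n + 1 - p) div 2)"
    by (rule sum_parity_columns[OF p])
  also have "2 * ((n + 1 - p) div 2) + (if 0 mod 2 = p then 0 else 1)
      + (if (n - 1) mod 2 = p then 0 else 1) = n + 1"
  proof -
    obtain m where "n = Suc m" using n by (cases n) auto
    moreover have "p = 0 \<or> p = 1" using p by auto
    ultimately show ?thesis by (elim disjE; simp; presburger)
  qed
  finally show ?thesis .
qed

lemma edge_ladder_cases:
  assumes "e \<in> edges (ladder n)"
  obtains (rung) c where "e = {(0, c), (1, c)}"
    | (rail) r c where "r < 2" "e = {(r, c), (r, Suc c)}"
proof -
  obtain x y where "e = {x, y}"
    using assms simple_graph_cartesian_product[OF simple_graph_path_graph simple_graph_path_graph]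
    unfolding simple_graph_def by meson
  moreover obtain r c r' c' where "x = (r, c)" "y = (r', c')" by (cases x; cases y)
  ultimately have e: "e = {(r, c), (r', c')}" and "adjacent (ladder n) (r, c) (r', c')"
    using assms by (auto simp: adjacent_def)
  hence "r < 2" "r' < 2" "r = r' \<and> (c' = Suc c \<or> c = Suc c') \<or> c = c' \<and> r \<noteq> r'"
    by (auto simp: adjacent_ladder)
  thus thesis
    using e rung rail by (auto simp: less_2_cases_iff insert_commute)
qed

lemma zigzag_avoiding_edge:
  assumes "e \<in> edges (ladder n)"
  obtains p s where "p < 2" "roman_dominating (delete_edges (ladder n) {e}) (zigzag n p s)"
  using assms
proof (cases rule: edge_ladder_cases)
  case (rung c)
  show thesis
  proof (rule that)
    show "(1 - c mod 2) < 2" by simp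
    show "roman_dominating (delete_edges (ladder n) {e}) (zigzag n (1 - c mod 2) 0)"
    proof (rule roman_dominating_zigzag)
      fix d assume "d mod 2 = 1 - c mod 2"
      hence "d \<noteq> c" by (cases "c mod 2 = 0") auto
      thus "{(0, d), (1, d)} \<notin> {e}" by (auto simp: rung doubleton_eq_iff)
    qed (auto simp: rung doubleton_eq_iff)
  qed
next
  case (rail r c)
  obtain s where s: "zigzag_row 0 s c \<noteq> r"
  proof -
    have "zigzag_row 0 0 c \<noteq> zigzag_row 0 1 c"
      unfolding zigzag_row_def by presburger
    thus thesis using that by metis
  qed
  show thesis
  proof (rule that)
    show "roman_dominating (delete_edges (ladder n) {e}) (zigzag n 0 s)"
      by (rule roman_dominating_zigzag) (use s in \<open>auto simp: rail doubleton_eq_iff\<close>)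
  qed simp
qed

lemma roman_dominating_delete_edges_mono:
  assumes "roman_dominating (delete_edges G B') f" and "B \<subseteq> B'"
  shows "roman_dominating (delete_edges G B) f"
proof -
  have "adjacent (delete_edges G B) x y" if "adjacent (delete_edges G B') x y" for x y
    using that assms(2) by (auto simp: adjacent_delete_edges)
  thus ?thesis
    using assms(1) unfolding roman_dominating_def by (fastforce simp: verts_delete_edges)
qed

lemma roman_domination_number_delete_edge_le:
  assumes n: "n \<ge> 2" and "e \<in> edges (ladder n)" and B: "B \<subseteq> {e}"
  shows "roman_domination_number (delete_edges (ladder n) B) \<le> n + 1"
proof -
  obtain p s where p: "p < 2"
    and dom: "roman_dominating (delete_edges (ladder n) {e}) (zigzag n p s)"
    using zigzag_avoiding_edge[OF assms(2)] by blast
  have "roman_domination_number (delete_edges (ladder n) B)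
      \<le> weight (delete_edges (ladder n) B) (zigzag n p s)"
    by (intro roman_domination_number_le roman_dominating_delete_edges_mono[OF dom B])
  also have "\<dots> = weight (ladder n) (zigzag n p s)"
    by (simp add: weight_def verts_delete_edges)
  also have "\<dots> = n + 1"
    by (rule weight_zigzag[OF p n])
  finally show ?thesis .
qed

section \<open>The Roman bondage number\<close>

theorem theorem3p2:
  fixes n :: nat
  assumes "n \<ge> 2"
  shows "roman_bondage_number (cartesian_product (path_graph 2) (path_graph n)) = 2"
proof (rule antisym)
  have some_edge: "{(0, 0), (0, 1)} \<in> edges (ladder n)"
    using first_cut_subset[OF assms] by (simp add: first_cut_def)
  have whole: "delete_edges (ladder n) {} = ladder n"
    by (simp add: delete_edges_def)
  have "roman_domination_number (ladder n) \<le> n + 1"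
    using roman_domination_number_delete_edge_le[OF assms some_edge, of "{}"] by (simp add: whole)
  hence "roman_domination_number (ladder n)
      < roman_domination_number (delete_edges (ladder n) first_cut)"
    using roman_domination_number_first_cut_ge[OF assms] by simp
  thus "roman_bondage_number (ladder n) \<le> 2"
    unfolding roman_bondage_number_def
    by (intro Inf_lower CollectI exI[of _ first_cut])
       (simp add: card_first_cut first_cut_subset[OF assms] numeral_eq_enat)
  show "2 \<le> roman_bondage_number (ladder n)"
    unfolding roman_bondage_number_def
  proof (rule Inf_greatest, elim CollectE exE conjE)
    fix k B
    assume k: "k = enat (card B)" and B: "B \<subseteq> edges (ladder n)"
      and more: "roman_domination_number (ladder n)
        < roman_domination_number (delete_edges (ladder n) B)"
    have "finite B"
      using B finite_edges[OF simple_graph_cartesian_product[OF simple_graph_path_graph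
            simple_graph_path_graph]] by (rule finite_subset)
    have "\<not> card B \<le> 1"
    proof
      assume "card B \<le> 1"
      hence "\<exists>e\<in>edges (ladder n). B \<subseteq> {e}"
        using \<open>finite B\<close> B some_edge by (auto simp: le_Suc_eq card_1_singleton_iff)
      hence "roman_domination_number (delete_edges (ladder n) B) \<le> n + 1"
        using roman_domination_number_delete_edge_le[OF assms] by blast
      thus False
        using more roman_domination_number_ladder_ge[of n] assms by simp
    qed
    thus "2 \<le> k" by (simp add: k numeral_eq_enat)
  qed
qed

end
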